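(* Let $T$ be a rooted, countably infinite tree without terminal vertices. Let $1\leqslant p<\infty$ and let $q$ be the conjugate exponent of $p$ (so $q=\infty$ if $p=1$). Let $\varphi:T\to\mathbb C$ be a function such that $\varphi$ and $\widehat{\varphi}$ are both in $\mathcal L^{q}(T)$, where $\widehat{\varphi}(v)=(|v|+1)\varphi'(v)$ for $v\in T$. Then the Toeplitz operator $T_\varphi$ is bounded on $\mathcal L^p(T)$, and its spectrum as a bounded operator on $\mathcal L^p(T)$ is $$\sigma(T_{\varphi})=\mathrm{clos}\{\varphi(v):v\in T\},$$ the closure in $\mathbb C$ of the range of $\varphi$.
   Context: A tree $T$ is a locally finite graph (every vertex has finitely many neighbors) in which any two vertices are joined by exactly one path (a finite sequence of distinct, successively adjacent vertices); $T$ is identified with its set of vertices. The set of vertices is countably infinite, and a distinguished vertex $o$ is called the root. A terminal vertex is a vertex with exactly one neighbor; $T$ is assumed to have none. The length $|v|$ is the number of edges in the path from $o$ to $v$. A vertex $w$ is a descendant of $v$ if $v$ lies on the path from $o$ to $w$. For $v\neq o$, $v^-$ denotes the unique neighbor of $v$ lying on the path from $o$ to $v$ (the parent of $v$). The sector $S_v$ is the set consisting of $v$ and all its descendants. For $1\leqslant p<\infty$, $\mathcal L^p(T)$ is the Banach space of functions $f:T\to\mathbb C$ with $\|f\|_p=\big(\sum_{v\in T}|f(v)|^p\big)^{1/p}<\infty$; $\mathcal L^\infty(T)$ is the space of bounded functions $f:T\to\mathbb C$ with the supremum norm. For $\varphi:T\to\mathbb C$, define $\varphi_-(v)=\varphi(v^-)$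 if $v\ne o$, $\varphi_-(o)=0$, and $\varphi'(v)=\varphi(v)-\varphi_-(v)$ for all $v\in T$ (so $\varphi'(o)=\varphi(o)$). For any $f:T\to\mathbb C$, define $(\nabla f)(u)=f(u)-\sum_{v:\,v^-=u}f(v)$, $u\in T$. For $f\in\mathcal L^1(T)$, define $(\Delta f)(u)=\sum_{v\in S_u}f(v)$, $u\in T$. The Toeplitz operator with symbol $\varphi$ on $\mathcal L^p(T)$ is $T_\varphi f=\Delta(\varphi\nabla f)$, $f\in\mathcal L^p(T)$. (It is known that $\varphi\nabla f\in\mathcal L^1(T)$ whenever $\varphi,\varphi'\in\mathcal L^q(T)$ and $f\in\mathcal L^p(T)$, with $q$ conjugate to $p$, so that this is well defined.) *)

theory Defs
  imports "HOL-Analysis.Analysis"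
begin

text \<open>The vertex set of the graph is the whole type \<open>'a\<close>; \<open>adj\<close> is the adjacency relation and
  \<open>r\<close> the root.\<close>

definition is_path :: "('a \<Rightarrow> 'a \<Rightarrow> bool) \<Rightarrow> 'a \<Rightarrow> 'a list \<Rightarrow> 'a \<Rightarrow> bool" where
  "is_path adj u xs v \<longleftrightarrow>
     xs \<noteq> [] \<and> hd xs = u \<and> last xs = v \<and> distinct xs \<and> successively adj xs"

locale tree =
  fixes adj :: "'a \<Rightarrow> 'a \<Rightarrow> bool"
  assumes adj_sym: "adj u v \<Longrightarrow> adj v u"
    and adj_irrefl: "\<not> adj v v"
    and locally_finite: "finite {w. adj v w}"
    and unique_path: "\<exists>!xs. is_path adj u xs v"

definition terminal_vertex :: "('a \<Rightarrow> 'a \<Rightarrow> bool) \<Rightarrow> 'a \<Rightarrow> bool" where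
  "terminal_vertex adj v \<longleftrightarrow> (\<exists>!w. adj v w)"

definition tree_path :: "('a \<Rightarrow> 'a \<Rightarrow> bool) \<Rightarrow> 'a \<Rightarrow> 'a \<Rightarrow> 'a list" where
  "tree_path adj u v = (THE xs. is_path adj u xs v)"

text \<open>The path is a list of vertices, so it has one edge fewer than its list length.\<close>

definition vertex_length :: "('a \<Rightarrow> 'a \<Rightarrow> bool) \<Rightarrow> 'a \<Rightarrow> 'a \<Rightarrow> nat" where
  "vertex_length adj r v = length (tree_path adj r v) - 1"

definition descendant :: "('a \<Rightarrow> 'a \<Rightarrow> bool) \<Rightarrow> 'a \<Rightarrow> 'a \<Rightarrow> 'a \<Rightarrow> bool" where
  "descendant adj r v w \<longleftrightarrow> v \<in> set (tree_path adj r w)"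

text \<open>Meaningful only for \<open>v \<noteq> r\<close>; at the root the value is unspecified.\<close>

definition parent :: "('a \<Rightarrow> 'a \<Rightarrow> bool) \<Rightarrow> 'a \<Rightarrow> 'a \<Rightarrow> 'a" where
  "parent adj r v = (THE u. adj v u \<and> u \<in> set (tree_path adj r v))"

definition sector :: "('a \<Rightarrow> 'a \<Rightarrow> bool) \<Rightarrow> 'a \<Rightarrow> 'a \<Rightarrow> 'a set" where
  "sector adj r v = insert v {w. descendant adj r v w}"

definition shift_fun :: "('a \<Rightarrow> 'a \<Rightarrow> bool) \<Rightarrow> 'a \<Rightarrow> ('a \<Rightarrow> complex) \<Rightarrow> 'a \<Rightarrow> complex" where
  "shift_fun adj r \<phi> v = (if v = r then 0 else \<phi> (parent adj r v))"

definition tree_deriv :: "('a \<Rightarrow> 'a \<Rightarrow> bool) \<Rightarrow> 'a \<Rightarrow> ('a \<Rightarrow> complex) \<Rightarrow> 'a \<Rightarrow> complex" where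
  "tree_deriv adj r \<phi> v = \<phi> v - shift_fun adj r \<phi> v"

definition weighted_deriv :: "('a \<Rightarrow> 'a \<Rightarrow> bool) \<Rightarrow> 'a \<Rightarrow> ('a \<Rightarrow> complex) \<Rightarrow> 'a \<Rightarrow> complex" where
  "weighted_deriv adj r \<phi> v = of_nat (vertex_length adj r v + 1) * tree_deriv adj r \<phi> v"

definition tree_nabla :: "('a \<Rightarrow> 'a \<Rightarrow> bool) \<Rightarrow> 'a \<Rightarrow> ('a \<Rightarrow> complex) \<Rightarrow> 'a \<Rightarrow> complex" where
  "tree_nabla adj r f u = f u - (\<Sum>v\<in>{v. v \<noteq> r \<and> parent adj r v = u}. f v)"

text \<open>For absolutely summable \<open>f\<close> this is the sum over the sector; other \<open>f\<close> are outside the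
  intended domain.\<close>

definition tree_Delta :: "('a \<Rightarrow> 'a \<Rightarrow> bool) \<Rightarrow> 'a \<Rightarrow> ('a \<Rightarrow> complex) \<Rightarrow> 'a \<Rightarrow> complex" where
  "tree_Delta adj r f u = (\<Sum>\<^sub>\<infinity>v\<in>sector adj r u. f v)"

definition toeplitz ::
    "('a \<Rightarrow> 'a \<Rightarrow> bool) \<Rightarrow> 'a \<Rightarrow> ('a \<Rightarrow> complex) \<Rightarrow> ('a \<Rightarrow> complex) \<Rightarrow> 'a \<Rightarrow> complex" where
  "toeplitz adj r \<phi> f = tree_Delta adj r (\<lambda>v. \<phi> v * tree_nabla adj r f v)"

definition lp :: "ennreal \<Rightarrow> ('a \<Rightarrow> complex) set" where
  "lp p = (if p = \<infinity> then {f. bounded (range f)}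
           else {f. (\<lambda>v. norm (f v) powr enn2real p) summable_on UNIV})"

definition lp_norm :: "ennreal \<Rightarrow> ('a \<Rightarrow> complex) \<Rightarrow> real" where
  "lp_norm p f = (if p = \<infinity> then (SUP v. norm (f v))
                  else (\<Sum>\<^sub>\<infinity>v. norm (f v) powr enn2real p) powr (1 / enn2real p))"

text \<open>Operators on \<open>lp p\<close> are maps on all functions of which only the restriction to \<open>lp p\<close>
  matters.\<close>

definition lp_bounded_operator ::
    "ennreal \<Rightarrow> (('a \<Rightarrow> complex) \<Rightarrow> ('a \<Rightarrow> complex)) \<Rightarrow> bool" where
  "lp_bounded_operator p A \<longleftrightarrow>
     (\<forall>f\<in>lp p. A f \<in> lp p) \<and>
     (\<forall>f\<in>lp p. \<forall>g\<in>lp p. A (\<lambda>v. f v + g v) = (\<lambda>v. A f v + A g v)) \<and>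
     (\<forall>c. \<forall>f\<in>lp p. A (\<lambda>v. c * f v) = (\<lambda>v. c * A f v)) \<and>
     (\<exists>C. \<forall>f\<in>lp p. lp_norm p (A f) \<le> C * lp_norm p f)"

definition lp_spectrum ::
    "ennreal \<Rightarrow> (('a \<Rightarrow> complex) \<Rightarrow> ('a \<Rightarrow> complex)) \<Rightarrow> complex set" where
  "lp_spectrum p A =
     {z. \<not> (\<exists>B. lp_bounded_operator p B \<and>
          (\<forall>f\<in>lp p. B (\<lambda>v. A f v - z * f v) = f \<and> (\<lambda>v. A (B f) v - z * B f v) = f))}"

end

theory Submission
  imports Defs
begin

text \<open>Summation by parts gives \<open>T\<^sub>\<phi> f (u) = \<phi>(u) f(u) + (\<Sum>w. \<phi>'(w) f(w))\<close>, the sum ranging over the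
  proper descendants \<open>w\<close> of \<open>u\<close>. The right-hand side makes sense for a larger class of symbols \<open>a\<close> and
  defines an operator \<open>A\<^sub>a\<close>, whose off-diagonal part maps \<open>lp p\<close> into \<open>lp 1\<close>: interchanging sums,
  the norm of the image is at most \<open>\<Sum>w. (|w| + 1) |a'(w)| |f(w)|\<close>, to which Hoelder applies.
  Telescoping along paths shows \<open>A\<^sub>a A\<^sub>b = A\<^sub>a\<^sub>b\<close>, so that for \<open>z\<close> outside the closure of the range
  the inverse of \<open>T\<^sub>\<phi> - z\<close> is \<open>A\<^sub>b\<close> with \<open>b = 1 / (\<phi> - z)\<close>. Conversely \<open>\<nabla>(T\<^sub>\<phi> f)(v) = \<phi>(v) \<nabla>f(v)\<close>,
  so every \<open>\<phi>(v)\<close> is an eigenvalue of the adjoint.\<close>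

subsection \<open>Ancestors and sectors in a rooted tree\<close>

text \<open>Any vertex may serve as the root, so fixing \<open>r\<close> adds no assumption.\<close>

locale rooted_tree = tree adj for adj :: "'a \<Rightarrow> 'a \<Rightarrow> bool" +
  fixes r :: 'a
begin

abbreviation "par \<equiv> parent adj r"
abbreviation "lev \<equiv> vertex_length adj r"

definition anc :: "'a \<Rightarrow> 'a set" where
  "anc v = set (tree_path adj r v)"

definition below :: "'a \<Rightarrow> 'a set" where
  "below u = {w. u \<in> anc w \<and> w \<noteq> u}"

definition children :: "'a \<Rightarrow> 'a set" where
  "children u = {v. v \<noteq> r \<and> par v = u}"

lemma is_path_tree_path: "is_path adj r (tree_path adj r v) v"
  unfolding tree_path_def by (rule theI') (rule unique_path)

lemma tree_path_eqI: "is_path adj r xs v \<Longrightarrow> tree_path adj r v = xs"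
  using unique_path is_path_tree_path by blast

lemma tree_path_root [simp]: "tree_path adj r r = [r]"
  by (rule tree_path_eqI) (simp add: is_path_def)

text \<open>Cut the path to \<open>v\<close> at its neighbor \<open>x\<close>: the initial piece
  followed by \<open>v\<close> is again a path from the root to \<open>v\<close>, so by uniqueness
  it is the whole path.\<close>

lemma tree_path_snoc:
  assumes "adj v x" and "x \<in> set (tree_path adj r v)"
  shows "tree_path adj r v = tree_path adj r x @ [v]"
proof -
  let ?P = "tree_path adj r v"
  have P: "is_path adj r ?P v" by (rule is_path_tree_path)
  obtain ys zs where split: "?P = (ys @ [x]) @ zs"
    using assms(2) by (metis append.assoc append_Cons append_Nil split_list)
  have xv: "x \<noteq> v" using assms(1) adj_irrefl by blast
  then have zs: "zs \<noteq> []" using P split by (auto simp: is_path_def)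
  have Px: "is_path adj r (ys @ [x]) x"
  proof -
    have "successively adj (ys @ [x])"
      using P unfolding is_path_def split by (metis successively_append_iff)
    then show ?thesis
      using P unfolding is_path_def split by (cases ys) auto
  qed
  have vlast: "v \<in> set zs" using P split zs unfolding is_path_def by auto
  then have "v \<notin> set (ys @ [x])" using P unfolding is_path_def split by auto
  then have "is_path adj r ((ys @ [x]) @ [v]) v"
    using Px adj_sym[OF assms(1)] unfolding is_path_def
    by (auto simp: successively_append_iff hd_append)
  then show ?thesis
    using tree_path_eqI[OF Px] tree_path_eqI[of "(ys @ [x]) @ [v]" v] by simp
qed

lemma parent_exists:
  assumes "v \<noteq> r"
  shows "\<exists>u. adj v u \<and> u \<in> set (tree_path adj r v)"
proof -
  let ?P = "tree_path adj r v"
  have P: "is_path adj r ?P v" by (rule is_path_tree_path)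
  then have split: "?P = butlast ?P @ [v]"
    unfolding is_path_def by (metis append_butlast_last_id)
  have ne: "butlast ?P \<noteq> []"
  proof
    assume "butlast ?P = []"
    then have "?P = [v]" using split by simp
    then show False using P assms by (simp add: is_path_def)
  qed
  have "successively adj (butlast ?P @ [v])" using P split by (simp add: is_path_def)
  then have "adj (last (butlast ?P)) v" using ne by (simp add: successively_append_iff)
  then show ?thesis using adj_sym ne by (meson in_set_butlastD last_in_set)
qed

text \<open>The description in \<open>parent\<close> is proper: for two candidates the paths to
  them, each followed by \<open>v\<close>, are the same path, so the candidates have equal paths and
  are equal.\<close>

lemma parent_props:
  assumes "v \<noteq> r"
  shows "adj v (par v)" and "par v \<in> set (tree_path adj r v)"
proof -
  obtain u where u: "adj v u \<and> u \<in> set (tree_path adj r v)"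
    using parent_exists[OF assms] by blast
  have uniq: "x = u" if "adj v x \<and> x \<in> set (tree_path adj r v)" for x
  proof -
    have "tree_path adj r x = tree_path adj r u" using tree_path_snoc[of v] that u by (metis append1_eq_conv)
    then show ?thesis using is_path_tree_path unfolding is_path_def by metis
  qed
  have "adj v (par v) \<and> par v \<in> set (tree_path adj r v)"
    unfolding parent_def by (rule theI, rule u, rule uniq)
  then show "adj v (par v)" and "par v \<in> set (tree_path adj r v)" by auto
qed

lemma tree_path_parent:
  "v \<noteq> r \<Longrightarrow> tree_path adj r v = tree_path adj r (par v) @ [v]"
  using tree_path_snoc parent_props by blast

lemma anc_root [simp]: "anc r = {r}"
  by (simp add: anc_def)

lemma anc_parent: "v \<noteq> r \<Longrightarrow> anc v = insert v (anc (par v))"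
  by (simp add: anc_def tree_path_parent)

lemma not_anc_parent: "v \<noteq> r \<Longrightarrow> v \<notin> anc (par v)"
  using is_path_tree_path[of v] by (auto simp: anc_def tree_path_parent is_path_def)

lemma finite_anc [simp]: "finite (anc v)"
  by (simp add: anc_def)

lemma self_in_anc [simp]: "v \<in> anc v"
  by (cases "v = r") (auto simp: anc_parent)

lemma lev_parent: "v \<noteq> r \<Longrightarrow> lev v = Suc (lev (par v))"
  using is_path_tree_path[of "par v"]
  by (cases "tree_path adj r (par v)") (auto simp: vertex_length_def tree_path_parent is_path_def)

lemma card_anc: "card (anc v) = lev v + 1"
  using is_path_tree_path[of v]
  by (cases "tree_path adj r v")
    (auto simp: anc_def vertex_length_def is_path_def distinct_card)

lemma parent_induct [case_names root parent]:
  assumes "P r" and "\<And>v. v \<noteq> r \<Longrightarrow> P (par v) \<Longrightarrow> P v"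
  shows "P v"
proof (induction "lev v" arbitrary: v rule: less_induct)
  case less
  then show ?case using assms lev_parent by (cases "v = r") auto
qed

lemma anc_lev: "u \<in> anc w \<Longrightarrow> u = w \<or> lev u < lev w"
  by (induction w rule: parent_induct) (auto simp: anc_parent lev_parent)

lemma anc_antisym: "u \<in> anc w \<Longrightarrow> w \<in> anc u \<Longrightarrow> u = w"
  using anc_lev[of u w] anc_lev[of w u] by auto

lemma anc_trans: "u \<in> anc v \<Longrightarrow> v \<in> anc w \<Longrightarrow> u \<in> anc w"
  by (induction w rule: parent_induct) (auto simp: anc_parent)

text \<open>A path from the root climbs one level per step. This is what separates the sectors of
  siblings.\<close>

lemma anc_unique_lev: "x \<in> anc w \<Longrightarrow> y \<in> anc w \<Longrightarrow> lev x = lev y \<Longrightarrow> x = y"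
proof (induction w rule: parent_induct)
  case (parent v)
  have "lev z < lev v" if "z \<in> anc (par v)" for z
    using anc_lev[OF that] lev_parent[OF parent.hyps] by auto
  then show ?case using parent anc_parent[OF parent.hyps] by (metis insertE less_irrefl)
qed auto

lemma sector_eq: "sector adj r u = {w. u \<in> anc w}"
  by (auto simp: sector_def descendant_def simp flip: anc_def)

lemma sector_insert: "sector adj r u = insert u (below u)" and not_below_self: "u \<notin> below u"
  by (auto simp: sector_eq below_def)

text \<open>This form trades strict descent of \<open>w\<close> for weak descent of its parent,
  which is how sums over \<open>below u\<close> get reindexed and telescoped.\<close>

lemma below_iff: "w \<in> below u \<longleftrightarrow> w \<noteq> r \<and> u \<in> anc (par w)"
  by (cases "w = r") (auto simp: below_def anc_parent not_anc_parent)

lemma below_trans: "v \<in> below u \<Longrightarrow> w \<in> below v \<Longrightarrow> w \<in> below u"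
  using anc_trans[of u v w] anc_antisym[of u v] by (auto simp: below_def)

lemma finite_children: "finite (children u)"
proof (rule finite_subset)
  show "children u \<subseteq> {w. adj u w}"
    using parent_props(1) adj_sym unfolding children_def by blast
qed (rule locally_finite)

lemma below_eq_Union: "below u = (\<Union>c\<in>children u. sector adj r c)"
proof (intro equalityI subsetI)
  fix w assume "w \<in> below u"
  then show "w \<in> (\<Union>c\<in>children u. sector adj r c)"
  proof (induction w rule: parent_induct)
    case root
    then show ?case by (simp add: below_iff)
  next
    case (parent v)
    show ?case
    proof (cases "par v = u")
      case True
      then show ?thesis using parent by (auto simp: children_def sector_eq)
    next
      case False
      moreover have "u \<in> anc (par v)" using parent.prems by (simp add: below_iff)
      ultimately have "par v \<in> below u" by (simp add: below_def)
      then show ?thesis using parent by (auto simp: sector_eq anc_parent)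
    qed
  qed
next
  fix w assume "w \<in> (\<Union>c\<in>children u. sector adj r c)"
  then obtain c where c: "c \<noteq> r" "par c = u" "c \<in> anc w"
    by (auto simp: children_def sector_eq)
  then have "u \<in> anc c" "u \<noteq> c" using anc_parent[of c] not_anc_parent[of c] by auto
  then show "w \<in> below u"
    using c(3) anc_trans[of u c w] anc_antisym[of u c] by (auto simp: below_def)
qed

lemma disjoint_child_sectors:
  assumes "c \<in> children u" "d \<in> children u" "c \<noteq> d"
  shows "sector adj r c \<inter> sector adj r d = {}"
proof -
  have "lev c = lev d" using assms lev_parent[of c] lev_parent[of d] by (simp add: children_def)
  then show ?thesis using assms(3) anc_unique_lev by (auto simp: sector_eq)
qed

text \<open>The index set is the path from \<open>u\<close> to \<open>x\<close> without
  \<open>u\<close>, so the increments along its edges telescope. The product formula for the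
  operators rests on this.\<close>

lemma telescope_between:
  fixes a :: "'a \<Rightarrow> complex"
  shows "u \<in> anc x \<Longrightarrow> (\<Sum>w\<in>{w \<in> anc x. w \<in> below u}. a w - a (par w)) = a x - a u"
proof (induction x rule: parent_induct)
  case root
  then have "{w \<in> anc r. w \<in> below u} = {}" by (auto simp: below_def)
  then have "(\<Sum>w\<in>{w \<in> anc r. w \<in> below u}. a w - a (par w)) = 0" by (simp only: sum.empty)
  with root show ?case by simp
next
  case (parent x)
  show ?case
  proof (cases "u = x")
    case True
    then have "{w \<in> anc x. w \<in> below u} = {}"
      using anc_antisym[of _ x] by (auto simp: below_def)
    with True show ?thesis by (metis diff_self sum.empty)
  next
    case False
    then have u: "u \<in> anc (par x)" using parent.prems anc_parent[OF parent.hyps] by auto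
    have "{w \<in> anc x. w \<in> below u} = insert x {w \<in> anc (par x). w \<in> below u}"
      using parent.hyps u anc_parent[of x] by (auto simp: below_iff[of x])
    then show ?thesis using parent u not_anc_parent[of x] by simp
  qed
qed

end

subsection \<open>The spaces of p-summable functions\<close>

context
  fixes p :: ennreal
  assumes p_ge_1: "1 \<le> p" and p_finite: "p < \<infinity>"
begin

lemma lp_exponent: "enn2real p \<ge> 1" "p = ennreal (enn2real p)"
proof -
  show "p = ennreal (enn2real p)" using p_finite by simp
  then show "enn2real p \<ge> 1" using p_ge_1 by (metis ennreal_1 ennreal_le_iff enn2real_nonneg)
qed

lemma exponent_ne_top: "p \<noteq> top"
  using p_finite by auto

lemma lp_iff: "f \<in> lp p \<longleftrightarrow> (\<lambda>v. norm (f v) powr enn2real p) summable_on UNIV"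
  using exponent_ne_top by (simp add: lp_def)

lemma lp_norm_nonneg: "0 \<le> lp_norm p f"
  using exponent_ne_top by (simp add: lp_norm_def)

lemma lp_norm_powr: "lp_norm p f powr enn2real p = (\<Sum>\<^sub>\<infinity>v. norm (f v) powr enn2real p)"
  using exponent_ne_top lp_exponent(1) by (simp add: lp_norm_def powr_powr infsum_nonneg)

lemma lp_norm_leI:
  assumes "(\<Sum>\<^sub>\<infinity>v. norm (f v) powr enn2real p) \<le> M powr enn2real p" and "0 \<le> M"
  shows "lp_norm p f \<le> M"
  using assms lp_exponent(1) powr_mono_both lp_norm_powr[of f]
  by (smt (verit) lp_norm_nonneg powr_less_mono2)

lemma norm_le_lp_norm:
  assumes "f \<in> lp p"
  shows "norm (f v) \<le> lp_norm p f"
proof -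
  have "norm (f v) powr enn2real p \<le> lp_norm p f powr enn2real p"
    unfolding lp_norm_powr
    using finite_sum_le_infsum[of "\<lambda>v. norm (f v) powr enn2real p" UNIV "{v}"] assms
    by (simp add: lp_iff)
  then show ?thesis
    using lp_exponent(1) lp_norm_nonneg[of f] by (smt (verit) powr_less_mono2 norm_ge_zero)
qed

lemma lp_dominated:
  assumes f: "f \<in> lp p" and le: "\<And>v. norm (g v) \<le> C * norm (f v)" and C: "0 \<le> C"
  shows "g \<in> lp p" and "lp_norm p g \<le> C * lp_norm p f"
proof -
  let ?P = "enn2real p"
  have pw: "norm (g v) powr ?P \<le> C powr ?P * norm (f v) powr ?P" for v
    using powr_mono2[OF _ norm_ge_zero le[of v], of ?P] lp_exponent(1) C by (simp add: powr_mult)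
  have s: "(\<lambda>v. C powr ?P * norm (f v) powr ?P) summable_on UNIV"
    using f by (intro summable_on_cmult_right) (simp add: lp_iff)
  have sg: "(\<lambda>v. norm (g v) powr ?P) summable_on UNIV"
    by (rule summable_on_comparison_test[OF s pw]) auto
  then show "g \<in> lp p" by (simp add: lp_iff)
  have "(\<Sum>\<^sub>\<infinity>v. norm (g v) powr ?P) \<le> (\<Sum>\<^sub>\<infinity>v. C powr ?P * norm (f v) powr ?P)"
    by (rule infsum_mono[OF sg s pw])
  also have "\<dots> = (C * lp_norm p f) powr ?P"
    using C lp_norm_nonneg by (simp add: infsum_cmult_right' powr_mult lp_norm_powr)
  finally show "lp_norm p g \<le> C * lp_norm p f"
    using C lp_norm_nonneg[of f] by (intro lp_norm_leI) auto
qed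

lemma lp_norm_eq_0: "f \<in> lp p \<Longrightarrow> lp_norm p f = 0 \<Longrightarrow> f v = 0"
  using norm_le_lp_norm[of f v] by simp

lemma lp_norm_scale:
  assumes "f \<in> lp p"
  shows "lp_norm p (\<lambda>v. c * f v) = norm c * lp_norm p f"
proof -
  have "lp_norm p (\<lambda>v. c * f v) powr enn2real p = (norm c * lp_norm p f) powr enn2real p"
    by (simp add: lp_norm_powr powr_mult norm_mult infsum_cmult_right' lp_norm_nonneg)
  then have "(lp_norm p (\<lambda>v. c * f v) powr enn2real p) powr (1 / enn2real p)
      = ((norm c * lp_norm p f) powr enn2real p) powr (1 / enn2real p)"
    by simp
  then show ?thesis
    using lp_exponent(1) unfolding powr_powr by (simp add: abs_mult lp_norm_nonneg)
qed

text \<open>The constant 2 replaces Minkowski's inequality, which is not needed in full strength.\<close>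

lemma lp_add:
  assumes f: "f \<in> lp p" and g: "g \<in> lp p"
  shows "(\<lambda>v. f v + g v) \<in> lp p"
    and "lp_norm p (\<lambda>v. f v + g v) \<le> 2 * (lp_norm p f + lp_norm p g)"
proof -
  let ?P = "enn2real p"
  have pw: "norm (f v + g v) powr ?P \<le> 2 powr ?P * (norm (f v) powr ?P + norm (g v) powr ?P)" for v
  proof -
    let ?m = "max (norm (f v)) (norm (g v))"
    have "norm (f v + g v) \<le> 2 * ?m" using norm_triangle_ineq[of "f v" "g v"] by linarith
    then have "norm (f v + g v) powr ?P \<le> (2 * ?m) powr ?P"
      using lp_exponent(1) by (intro powr_mono2) auto
    also have "\<dots> = 2 powr ?P * ?m powr ?P" by (simp add: powr_mult)
    also have "?m powr ?P \<le> norm (f v) powr ?P + norm (g v) powr ?P"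
      by (simp add: max_def)
    finally show ?thesis by simp
  qed
  have s: "(\<lambda>v. norm (f v) powr ?P) summable_on UNIV" "(\<lambda>v. norm (g v) powr ?P) summable_on UNIV"
    using f g by (simp_all add: lp_iff)
  then have s2: "(\<lambda>v. 2 powr ?P * (norm (f v) powr ?P + norm (g v) powr ?P)) summable_on UNIV"
    by (intro summable_on_cmult_right summable_on_add)
  have sfg: "(\<lambda>v. norm (f v + g v) powr ?P) summable_on UNIV"
    by (rule summable_on_comparison_test[OF s2 pw]) auto
  then show "(\<lambda>v. f v + g v) \<in> lp p" by (simp add: lp_iff)
  let ?F = "lp_norm p f" and ?G = "lp_norm p g"
  \<comment> \<open>Splitting off one factor and enlarging the base of the remaining power
    \<open>?P - 1 \<ge> 0\<close> shows that \<open>x powr ?P\<close> is superadditive on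
    nonnegative reals.\<close>
  have split: "x powr ?P = x * x powr (?P - 1)" if "x \<ge> 0" for x :: real
    using that lp_exponent(1) powr_mult_base[of x "?P - 1"] by simp
  have "?F powr ?P + ?G powr ?P = ?F * ?F powr (?P - 1) + ?G * ?G powr (?P - 1)"
    using split[OF lp_norm_nonneg[of f]] split[OF lp_norm_nonneg[of g]] by simp
  also have "\<dots> \<le> ?F * (?F + ?G) powr (?P - 1) + ?G * (?F + ?G) powr (?P - 1)"
    using lp_norm_nonneg[of f] lp_norm_nonneg[of g] lp_exponent(1)
    by (intro add_mono mult_left_mono powr_mono2) auto
  also have "\<dots> = (?F + ?G) powr ?P"
    using split[of "?F + ?G"] lp_norm_nonneg[of f] lp_norm_nonneg[of g]
    by (simp add: algebra_simps)
  finally have FG: "?F powr ?P + ?G powr ?P \<le> (?F + ?G) powr ?P" .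
  have "(\<Sum>\<^sub>\<infinity>v. norm (f v + g v) powr ?P)
      \<le> (\<Sum>\<^sub>\<infinity>v. 2 powr ?P * (norm (f v) powr ?P + norm (g v) powr ?P))"
    by (rule infsum_mono[OF sfg s2 pw])
  also have "\<dots> = 2 powr ?P * (?F powr ?P + ?G powr ?P)"
    using s by (simp add: infsum_cmult_right' infsum_add lp_norm_powr)
  also have "\<dots> \<le> (2 * (?F + ?G)) powr ?P"
    using FG lp_norm_nonneg[of f] lp_norm_nonneg[of g] by (simp only: powr_mult mult_left_mono powr_ge_zero)
  finally show "lp_norm p (\<lambda>v. f v + g v) \<le> 2 * (?F + ?G)"
    using lp_norm_nonneg[of f] lp_norm_nonneg[of g] by (intro lp_norm_leI) auto
qed

text \<open>Every value is at most the total \<open>M\<close>, so each \<open>?P\<close>-th power is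
  at most \<open>M powr (?P - 1)\<close> times the value itself; summing gives at most
  \<open>M powr ?P\<close>.\<close>

lemma abs_summable_in_lp:
  assumes h: "(\<lambda>v. norm (h v)) summable_on UNIV"
  shows "h \<in> lp p" and "lp_norm p h \<le> (\<Sum>\<^sub>\<infinity>v. norm (h v))"
proof -
  let ?P = "enn2real p"
  define M where "M = (\<Sum>\<^sub>\<infinity>v. norm (h v))"
  have M: "0 \<le> M" by (simp add: M_def infsum_nonneg)
  have hM: "norm (h v) \<le> M" for v
    unfolding M_def using finite_sum_le_infsum[OF h, of "{v}"] by simp
  have split: "x powr ?P = x * x powr (?P - 1)" if "x \<ge> 0" for x :: real
    using that lp_exponent(1) powr_mult_base[of x "?P - 1"] by simp
  have pw: "norm (h v) powr ?P \<le> M powr (?P - 1) * norm (h v)" for v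
    using split[of "norm (h v)"] hM lp_exponent(1)
    by (simp add: mult.commute mult_left_mono powr_mono2)
  have s: "(\<lambda>v. M powr (?P - 1) * norm (h v)) summable_on UNIV"
    using h by (intro summable_on_cmult_right)
  have sh: "(\<lambda>v. norm (h v) powr ?P) summable_on UNIV"
    by (rule summable_on_comparison_test[OF s pw]) auto
  then show "h \<in> lp p" by (simp add: lp_iff)
  have "(\<Sum>\<^sub>\<infinity>v. norm (h v) powr ?P) \<le> (\<Sum>\<^sub>\<infinity>v. M powr (?P - 1) * norm (h v))"
    by (rule infsum_mono[OF sh s pw])
  also have "\<dots> = M powr ?P"
    unfolding infsum_cmult_right' M_def[symmetric] using split[OF M] by simp
  finally show "lp_norm p h \<le> (\<Sum>\<^sub>\<infinity>v. norm (h v))"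
    using M unfolding M_def by (rule lp_norm_leI)
qed

section \<open>Conjugate exponents and Hoelder's inequality\<close>

lemma conjugate_exponent_cases:
  assumes "1 / p + 1 / q = (1 :: ennreal)"
  obtains (one) "q = \<infinity>" "enn2real p = 1"
    | (real) "q \<noteq> \<infinity>" "enn2real p > 1" "enn2real q > 1" "1 / enn2real p + 1 / enn2real q = 1"
proof (cases "q = \<infinity>")
  case True
  then have "1 / ennreal (enn2real p) = 1" using assms lp_exponent(2) by simp
  then have "ennreal (1 / enn2real p) = ennreal 1"
    using lp_exponent(1) divide_ennreal[of 1 "enn2real p"] by simp
  then have "enn2real p = 1" using lp_exponent(1) by (simp add: ennreal_inj)
  then show ?thesis using True one by blast
next
  case False
  define P Q where "P = enn2real p" and "Q = enn2real q"
  have p: "p = ennreal P" and P: "P \<ge> 1" using lp_exponent by (simp_all add: P_def)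
  have q: "q = ennreal Q" using False by (simp add: Q_def top.not_eq_extremum)
  \<comment> \<open>In \<open>ennreal\<close> the quotient \<open>1 / 0\<close> is infinite, so it
    cannot be a summand of 1.\<close>
  have "Q \<noteq> 0"
  proof
    assume "Q = 0"
    then show False using assms q by (simp add: ennreal_divide_zero)
  qed
  then have Q: "Q > 0" using enn2real_nonneg[of q] by (simp add: Q_def order_less_le)
  have "ennreal (1 / P + 1 / Q) = ennreal 1"
    using assms P Q p q divide_ennreal[of 1 P] divide_ennreal[of 1 Q] by (simp add: ennreal_plus)
  then have sum: "1 / P + 1 / Q = 1" using P Q by (subst (asm) ennreal_inj) auto
  then have "P > 1" using P Q by (cases "P = 1") auto
  moreover have "1 / P > 0" using P by simp
  then have "1 / Q < 1" using sum by linarith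
  then have "Q > 1" using Q by (simp add: field_simps)
  ultimately show ?thesis using False sum real unfolding P_def Q_def
    by simp
qed

text \<open>Only some constant depending on \<open>g\<close> is wanted, not the sharp norm. For
  \<open>p = 1\<close> it is a bound of \<open>g\<close>; otherwise Young's inequality is summed for
  \<open>f\<close> of norm 1 and the result is extended by homogeneity.\<close>

lemma holder_bound:
  assumes pq: "1 / p + 1 / q = 1" and g: "g \<in> lp q"
  obtains C where "0 \<le> C"
    and "\<And>f. f \<in> lp p \<Longrightarrow> (\<lambda>v. norm (g v * f v)) summable_on UNIV"
    and "\<And>f. f \<in> lp p \<Longrightarrow> (\<Sum>\<^sub>\<infinity>v. norm (g v * f v)) \<le> C * lp_norm p f"
  using pq
proof (cases rule: conjugate_exponent_cases)
  case one
  then obtain C where C: "norm (g v) \<le> C" for v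
    using g unfolding lp_def bounded_iff by auto
  have C0: "0 \<le> C" using C norm_ge_zero order_trans by blast
  have s: "(\<lambda>v. C * norm (f v)) summable_on UNIV" if "f \<in> lp p" for f
    using that one by (intro summable_on_cmult_right) (simp add: lp_iff)
  have pw: "norm (g v * f v) \<le> C * norm (f v)" for f v
    using C by (simp add: norm_mult mult_right_mono)
  have sg: "(\<lambda>v. norm (g v * f v)) summable_on UNIV" if "f \<in> lp p" for f
    using s[OF that] by (rule summable_on_comparison_test) (simp_all only: pw norm_ge_zero)
  have "(\<Sum>\<^sub>\<infinity>v. norm (g v * f v)) \<le> C * lp_norm p f" if "f \<in> lp p" for f
  proof -
    have "(\<Sum>\<^sub>\<infinity>v. norm (g v * f v)) \<le> (\<Sum>\<^sub>\<infinity>v. C * norm (f v))"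
      using sg[OF that] s[OF that] by (rule infsum_mono) (rule pw)
    then show ?thesis
      using lp_norm_powr[of f] lp_norm_nonneg[of f] one by (simp add: infsum_cmult_right')
  qed
  then show thesis using that C0 sg by blast
next
  case real
  let ?P = "enn2real p" and ?Q = "enn2real q"
  define D where "D = (\<Sum>\<^sub>\<infinity>v. 1 / ?Q * norm (g v) powr ?Q)"
  have sQ: "(\<lambda>v. 1 / ?Q * norm (g v) powr ?Q) summable_on UNIV"
    using g real by (intro summable_on_cmult_right) (auto simp: lp_def)
  have pw: "norm (g v * f v) \<le> 1 / ?P * norm (f v) powr ?P + 1 / ?Q * norm (g v) powr ?Q" for f v
    using Youngs_inequality[of ?P ?Q "norm (f v)" "norm (g v)"] real
    by (simp add: norm_mult mult.commute[of "norm (g v)"])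
  have s: "(\<lambda>v. 1 / ?P * norm (f v) powr ?P + 1 / ?Q * norm (g v) powr ?Q) summable_on UNIV"
    if "f \<in> lp p" for f
    using that by (intro summable_on_add summable_on_cmult_right sQ) (simp add: lp_iff)
  have sg: "(\<lambda>v. norm (g v * f v)) summable_on UNIV" if "f \<in> lp p" for f
    using s[OF that] by (rule summable_on_comparison_test) (simp_all only: pw norm_ge_zero)
  have D: "0 \<le> D" using real by (auto simp: D_def intro!: infsum_nonneg)
  \<comment> \<open>With norm 1 the two Young sums are \<open>1 / ?P \<le> 1\<close> and
    \<open>D\<close>.\<close>
  have unit: "(\<Sum>\<^sub>\<infinity>v. norm (g v * f v)) \<le> 1 + D" if "f \<in> lp p" "lp_norm p f = 1" for f
  proof -
    have "(\<Sum>\<^sub>\<infinity>v. norm (g v * f v))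
        \<le> (\<Sum>\<^sub>\<infinity>v. 1 / ?P * norm (f v) powr ?P + 1 / ?Q * norm (g v) powr ?Q)"
      using sg[OF that(1)] s[OF that(1)] by (rule infsum_mono) (rule pw)
    also have "\<dots> = (\<Sum>\<^sub>\<infinity>v. 1 / ?P * norm (f v) powr ?P) + D"
      unfolding D_def using that(1)
      by (intro infsum_add sQ summable_on_cmult_right) (simp add: lp_iff)
    also have "(\<Sum>\<^sub>\<infinity>v. 1 / ?P * norm (f v) powr ?P) = 1 / ?P"
      using that(2) unfolding infsum_cmult_right' lp_norm_powr[symmetric] by simp
    also have "1 / ?P \<le> 1" using real by simp
    finally show ?thesis by simp
  qed
  have "(\<Sum>\<^sub>\<infinity>v. norm (g v * f v)) \<le> (1 + D) * lp_norm p f" if f: "f \<in> lp p" for f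
  proof (cases "lp_norm p f = 0")
    case True
    then show ?thesis using lp_norm_eq_0[OF f] by simp
  next
    case False
    define N where "N = lp_norm p f"
    have N: "N > 0" using False lp_norm_nonneg[of f] by (simp add: N_def)
    define f1 where "f1 = (\<lambda>v. complex_of_real (1 / N) * f v)"
    have "f1 \<in> lp p"
      using lp_dominated(1)[OF f, of f1 "1 / N"] N by (simp add: f1_def norm_mult norm_divide)
    moreover have "lp_norm p f1 = 1"
      using lp_norm_scale[OF f, of "complex_of_real (1 / N)"] N
      by (simp add: f1_def N_def norm_divide)
    ultimately have "(\<Sum>\<^sub>\<infinity>v. norm (g v * f1 v)) \<le> 1 + D" by (rule unit)
    moreover have "norm (g v * f v) = N * norm (g v * f1 v)" for v
      using N by (simp add: f1_def norm_mult norm_divide)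
    then have "(\<Sum>\<^sub>\<infinity>v. norm (g v * f v)) = N * (\<Sum>\<^sub>\<infinity>v. norm (g v * f1 v))"
      by (simp add: infsum_cmult_right')
    ultimately show ?thesis using N by (simp add: N_def mult.commute mult_left_mono)
  qed
  then show thesis using that[of "1 + D"] D sg by auto
qed

end

subsection \<open>Operators with a symbol\<close>

lemma
  fixes f g :: "'b \<Rightarrow> 'c :: {topological_ab_group_add, t2_space}"
  assumes "f summable_on A" and "g summable_on A"
  shows summable_on_diff: "(\<lambda>x. f x - g x) summable_on A"
    and infsum_diff: "infsum (\<lambda>x. f x - g x) A = infsum f A - infsum g A"
  using summable_on_add[of f A "\<lambda>x. - g x"] infsum_add[of f A "\<lambda>x. - g x"] assms
  by (simp_all add: infsum_uminus summable_on_uminus)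

context rooted_tree
begin

text \<open>The increment of \<open>a\<close> along the edge above \<open>v\<close>; unlike \<open>tree_deriv\<close> it ignores the root,
  so that it is unchanged when a constant is added to \<open>a\<close>.\<close>

definition incr :: "('a \<Rightarrow> complex) \<Rightarrow> 'a \<Rightarrow> complex" where
  "incr a v = (if v = r then 0 else a v - a (par v))"

definition tail_sum :: "('a \<Rightarrow> complex) \<Rightarrow> 'a \<Rightarrow> complex" where
  "tail_sum h u = (\<Sum>\<^sub>\<infinity>w\<in>below u. h w)"

text \<open>The operator \<open>A\<^sub>a\<close>. Starting from the formula after summation by
  parts admits constants and \<open>1 / (\<phi> - z)\<close> as symbols, for which the product of
  \<open>a\<close> with \<open>tree_nabla adj r f\<close> need not be summable.\<close>

definition symbol_op :: "('a \<Rightarrow> complex) \<Rightarrow> ('a \<Rightarrow> complex) \<Rightarrow> 'a \<Rightarrow> complex" where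
  "symbol_op a f u = a u * f u + tail_sum (\<lambda>w. incr a w * f w) u"

text \<open>The weight is the number of vertices in \<open>anc w\<close>, the factor that appears
  when a double sum over pairs of a vertex and one of its descendants is interchanged.\<close>

definition level_summable :: "('a \<Rightarrow> complex) \<Rightarrow> bool" where
  "level_summable h \<longleftrightarrow> (\<lambda>w. real (lev w + 1) * norm (h w)) summable_on UNIV"

lemma level_summable_imp_abs_summable:
  assumes "level_summable h"
  shows "(\<lambda>w. norm (h w)) summable_on A"
proof -
  have le: "norm (h w) \<le> real (lev w + 1) * norm (h w)" for w
    using mult_right_mono[of 1 "real (lev w + 1)" "norm (h w)"] by simp
  have "(\<lambda>w. norm (h w)) summable_on UNIV"
    using assms[unfolded level_summable_def]
    by (rule summable_on_comparison_test) (rule le, simp)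
  then show ?thesis by (rule summable_on_subset_banach) simp
qed

lemma level_summable_imp_summable: "level_summable h \<Longrightarrow> h summable_on A"
  by (rule abs_summable_summable) (rule level_summable_imp_abs_summable)

lemma level_summable_mult:
  assumes "level_summable h" and "\<And>w. norm (b w) \<le> C"
  shows "level_summable (\<lambda>w. b w * h w)"
  unfolding level_summable_def
proof (rule summable_on_comparison_test)
  show "(\<lambda>w. C * (real (lev w + 1) * norm (h w))) summable_on UNIV"
    using assms(1) unfolding level_summable_def by (rule summable_on_cmult_right)
  show "real (lev w + 1) * norm (b w * h w) \<le> C * (real (lev w + 1) * norm (h w))" for w
  proof -
    have "norm (b w) * (real (lev w + 1) * norm (h w)) \<le> C * (real (lev w + 1) * norm (h w))"
      using assms(2) by (intro mult_right_mono) auto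
    then show ?thesis by (simp add: norm_mult mult.left_commute)
  qed
qed simp

lemma tail_sum_add:
  "level_summable g \<Longrightarrow> level_summable h \<Longrightarrow>
    tail_sum (\<lambda>w. g w + h w) u = tail_sum g u + tail_sum h u"
  by (simp add: tail_sum_def infsum_add level_summable_imp_summable)

lemma tail_sum_scale: "tail_sum (\<lambda>w. c * h w) u = c * tail_sum h u"
  by (simp add: tail_sum_def infsum_cmult_right')

text \<open>Interchanging the sums, each \<open>w\<close> is counted once for every strict ancestor.\<close>

lemma tail_sum_summable:
  assumes h: "level_summable h"
  shows "(\<lambda>u. norm (tail_sum h u)) summable_on UNIV"
    and "(\<Sum>\<^sub>\<infinity>u. norm (tail_sum h u)) \<le> (\<Sum>\<^sub>\<infinity>w. real (lev w + 1) * norm (h w))"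
proof -
  define F where "F = (\<lambda>w u. if w \<in> below u then norm (h w) else 0)"
  define b where "b w = (\<Sum>u\<in>anc w. F w u)" for w
  have inner: "(F w has_sum b w) UNIV" for w
    unfolding b_def
    by (rule has_sum_finite_neutralI[where B = "anc w"]) (auto simp: F_def below_def)
  \<comment> \<open>The set \<open>anc w\<close> contains \<open>w\<close> itself, where
    \<open>F w\<close> vanishes, so the weight \<open>lev w + 1\<close> exceeds the number of strict
    ancestors by one.\<close>
  have b_le: "b w \<le> real (lev w + 1) * norm (h w)" for w
  proof -
    have "b w \<le> (\<Sum>u\<in>anc w. norm (h w))" unfolding b_def F_def by (intro sum_mono) auto
    then show ?thesis by (simp add: card_anc)
  qed
  have b_nonneg: "0 \<le> b w" for w unfolding b_def F_def by (intro sum_nonneg) auto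
  have b_sum: "b summable_on UNIV"
    using h unfolding level_summable_def
    by (rule summable_on_comparison_test) (use b_le b_nonneg in auto)
  have F_sum: "(\<lambda>(w, u). F w u) summable_on UNIV \<times> UNIV"
    by (rule summable_on_SigmaI[OF _ b_sum]) (auto simp: F_def inner[unfolded F_def])
  have F_sum': "(\<lambda>(u, w). F w u) summable_on UNIV \<times> UNIV"
    using summable_on_swap[THEN iffD1, OF F_sum] by simp
  have col: "infsum (\<lambda>w. F w u) UNIV = infsum (\<lambda>w. norm (h w)) (below u)" for u
    by (rule infsum_cong_neutral) (auto simp: F_def)
  have le: "norm (tail_sum h u) \<le> infsum (\<lambda>w. F w u) UNIV" for u
    unfolding tail_sum_def col
    by (rule norm_infsum_bound) (rule level_summable_imp_abs_summable[OF h])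
  have outer: "(\<lambda>u. infsum (\<lambda>w. F w u) UNIV) summable_on UNIV"
    by (rule summable_on_Sigma_banach[OF F_sum'])
  show s: "(\<lambda>u. norm (tail_sum h u)) summable_on UNIV"
    using outer by (rule summable_on_comparison_test) (use le in auto)
  have "(\<Sum>\<^sub>\<infinity>u. norm (tail_sum h u)) \<le> (\<Sum>\<^sub>\<infinity>u. infsum (\<lambda>w. F w u) UNIV)"
    using s outer by (rule infsum_mono) (rule le)
  also have "\<dots> = (\<Sum>\<^sub>\<infinity>w. infsum (F w) UNIV)"
    by (rule infsum_swap_banach[OF F_sum', simplified])
  also have "\<dots> = (\<Sum>\<^sub>\<infinity>w. b w)" by (intro infsum_cong infsumI inner)
  also have "\<dots> \<le> (\<Sum>\<^sub>\<infinity>w. real (lev w + 1) * norm (h w))"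
    using b_sum h[unfolded level_summable_def] by (rule infsum_mono) (rule b_le)
  finally show "(\<Sum>\<^sub>\<infinity>u. norm (tail_sum h u)) \<le> (\<Sum>\<^sub>\<infinity>w. real (lev w + 1) * norm (h w))" .
qed

lemma norm_incr_le:
  assumes "\<And>v. norm (a v) \<le> M"
  shows "norm (incr a w) \<le> 2 * M"
proof -
  have "0 \<le> M" using assms norm_ge_zero order_trans by blast
  moreover have "norm (a w - a (par w)) \<le> 2 * M"
    using norm_triangle_ineq4[of "a w" "a (par w)"] assms[of w] assms[of "par w"] by linarith
  ultimately show ?thesis by (simp add: incr_def)
qed

text \<open>The left side is a double sum over pairs with \<open>w\<close> strictly below
  \<open>u\<close> and \<open>x\<close> strictly below \<open>w\<close>. It converges absolutely,
  and for fixed \<open>x\<close> the increments of \<open>a\<close> at the admissible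
  \<open>w\<close> telescope from \<open>u\<close> to the parent of \<open>x\<close>.\<close>

lemma tail_sum_incr_tail_sum:
  assumes h: "level_summable h" and a: "\<And>v. norm (a v) \<le> M"
  shows "tail_sum (\<lambda>w. incr a w * tail_sum h w) u = tail_sum (\<lambda>x. (a (par x) - a u) * h x) u"
proof -
  define G where "G = (\<lambda>x w. if w \<in> below u \<and> x \<in> below w then incr a w * h x else 0)"
  define b where "b x = (\<Sum>w\<in>anc x. norm (G x w))" for x
  have inner: "((\<lambda>w. norm (G x w)) has_sum b x) UNIV" for x
    unfolding b_def
    by (rule has_sum_finite_neutralI[where B = "anc x"]) (auto simp: G_def below_def)
  have b_le: "b x \<le> 2 * M * (real (lev x + 1) * norm (h x))" for x
  proof -
    have "norm (G x w) \<le> 2 * M * norm (h x)" for w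
      using norm_incr_le[of a M w, OF a] order_trans[OF norm_ge_zero a]
      by (simp add: G_def norm_mult mult_right_mono)
    then have "b x \<le> (\<Sum>w\<in>anc x. 2 * M * norm (h x))" unfolding b_def by (intro sum_mono)
    then show ?thesis by (simp add: card_anc algebra_simps)
  qed
  have b_nonneg: "0 \<le> b x" for x unfolding b_def by (intro sum_nonneg) auto
  have b_sum: "b summable_on UNIV"
    using summable_on_cmult_right[OF h[unfolded level_summable_def], of "2 * M"]
    by (rule summable_on_comparison_test) (use b_le b_nonneg in auto)
  have "(\<lambda>xw. norm (case xw of (x, w) \<Rightarrow> G x w)) summable_on UNIV \<times> UNIV"
    by (rule summable_on_SigmaI[OF _ b_sum]) (use inner in auto)
  then have G_sum: "(\<lambda>(x, w). G x w) summable_on UNIV \<times> UNIV"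
    by (rule abs_summable_summable)
  have row: "(\<Sum>\<^sub>\<infinity>x. G x w) = (if w \<in> below u then incr a w * tail_sum h w else 0)" for w
  proof (cases "w \<in> below u")
    case True
    then have "(\<Sum>\<^sub>\<infinity>x. G x w) = (\<Sum>\<^sub>\<infinity>x\<in>below w. incr a w * h x)"
      by (intro infsum_cong_neutral) (auto simp: G_def)
    with True show ?thesis by (simp add: tail_sum_def infsum_cmult_right')
  qed (simp add: G_def)
  have col: "(\<Sum>\<^sub>\<infinity>w. G x w) = (if x \<in> below u then (a (par x) - a u) * h x else 0)" for x
  proof (cases "x \<in> below u")
    case True
    then have x: "x \<noteq> r" "u \<in> anc (par x)" by (auto simp: below_iff)
    \<comment> \<open>The strict ancestors of \<open>x\<close> are the members of
      \<open>anc (par x)\<close>; hence the telescoping ends at \<open>par x\<close> and not at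
      \<open>x\<close>.\<close>
    let ?S = "{w \<in> anc (par x). w \<in> below u}"
    have "(\<Sum>\<^sub>\<infinity>w. G x w) = (\<Sum>w\<in>?S. (a w - a (par w)) * h x)"
      using x by (intro infsumI has_sum_finite_neutralI[where B = ?S])
        (auto simp: G_def below_iff incr_def)
    then show ?thesis
      using True telescope_between[OF x(2)] by (simp flip: sum_distrib_right)
  next
    case False
    then have "G x w = 0" for w using below_trans by (auto simp: G_def)
    with False show ?thesis by simp
  qed
  have "tail_sum (\<lambda>w. incr a w * tail_sum h w) u = (\<Sum>\<^sub>\<infinity>w. \<Sum>\<^sub>\<infinity>x. G x w)"
    unfolding tail_sum_def[of _ u] by (rule infsum_cong_neutral) (auto simp: row)
  also have "\<dots> = (\<Sum>\<^sub>\<infinity>x. \<Sum>\<^sub>\<infinity>w. G x w)"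
    by (rule infsum_swap_banach[OF G_sum, symmetric])
  also have "\<dots> = tail_sum (\<lambda>x. (a (par x) - a u) * h x) u"
    unfolding tail_sum_def by (rule infsum_cong_neutral) (auto simp: col)
  finally show ?thesis .
qed

text \<open>The last two clauses extract from \<open>weighted_deriv a \<in> lp q\<close> exactly what boundedness on
  \<open>lp p\<close> needs; they are stable under \<open>a \<mapsto> 1 / (a - z)\<close>, whereas \<open>a \<in> lp q\<close> is not.\<close>

definition symbol :: "ennreal \<Rightarrow> ('a \<Rightarrow> complex) \<Rightarrow> bool" where
  "symbol p a \<longleftrightarrow> (\<exists>M. \<forall>v. norm (a v) \<le> M) \<and>
     (\<forall>f\<in>lp p. level_summable (\<lambda>w. incr a w * f w)) \<and>
     (\<exists>C\<ge>0. \<forall>f\<in>lp p. (\<Sum>\<^sub>\<infinity>w. real (lev w + 1) * norm (incr a w * f w)) \<le> C * lp_norm p f)"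

text \<open>All clauses of \<open>symbol\<close> except boundedness see only the size of the
  increments. This transfers them to \<open>a - z\<close> and to reciprocals.\<close>

lemma symbol_dominated:
  assumes a: "symbol p a" and b: "\<And>v. norm (b v) \<le> M"
    and le: "\<And>w. norm (incr b w) \<le> K * norm (incr a w)" and K: "0 \<le> K"
  shows "symbol p b"
proof -
  obtain C where C: "C \<ge> 0" and Cb: "\<And>f. f \<in> lp p \<Longrightarrow>
      (\<Sum>\<^sub>\<infinity>w. real (lev w + 1) * norm (incr a w * f w)) \<le> C * lp_norm p f"
    using a unfolding symbol_def by blast
  have pw: "real (lev w + 1) * norm (incr b w * f w)
      \<le> K * (real (lev w + 1) * norm (incr a w * f w))" for f w
  proof -
    have "norm (incr b w) * (real (lev w + 1) * norm (f w))
        \<le> K * norm (incr a w) * (real (lev w + 1) * norm (f w))"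
      using le by (intro mult_right_mono) auto
    then show ?thesis by (simp only: norm_mult mult_ac)
  qed
  have s: "(\<lambda>w. K * (real (lev w + 1) * norm (incr a w * f w))) summable_on UNIV"
    if "f \<in> lp p" for f
    using a that unfolding symbol_def level_summable_def by (intro summable_on_cmult_right) blast
  have lb: "level_summable (\<lambda>w. incr b w * f w)" if "f \<in> lp p" for f
    unfolding level_summable_def using s[OF that]
    by (rule summable_on_comparison_test) (rule pw, simp)
  have "(\<Sum>\<^sub>\<infinity>w. real (lev w + 1) * norm (incr b w * f w)) \<le> (K * C) * lp_norm p f"
    if f: "f \<in> lp p" for f
  proof -
    have "(\<Sum>\<^sub>\<infinity>w. real (lev w + 1) * norm (incr b w * f w))
        \<le> (\<Sum>\<^sub>\<infinity>w. K * (real (lev w + 1) * norm (incr a w * f w)))"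
      using lb[OF f, unfolded level_summable_def] s[OF f] by (rule infsum_mono) (rule pw)
    also have "\<dots> \<le> K * (C * lp_norm p f)"
      unfolding infsum_cmult_right' using Cb[OF f] K by (rule mult_left_mono)
    finally show ?thesis by (simp add: mult.assoc)
  qed
  then show ?thesis unfolding symbol_def using b lb K C by (meson mult_nonneg_nonneg)
qed

section \<open>Boundedness and multiplicativity of the operators\<close>

lemma symbol_op_const: "symbol_op (\<lambda>_. c) f = (\<lambda>v. c * f v)"
proof -
  have "incr (\<lambda>_. c) = (\<lambda>_. 0)" by (simp add: incr_def fun_eq_iff)
  then show ?thesis by (simp add: symbol_op_def tail_sum_def fun_eq_iff[of "symbol_op _ _"])
qed

lemma incr_diff_const: "incr (\<lambda>v. a v - z) = incr a"
  by (simp add: incr_def fun_eq_iff)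

lemma symbol_op_diff_const: "symbol_op (\<lambda>v. a v - z) f = (\<lambda>v. symbol_op a f v - z * f v)"
  by (simp add: symbol_op_def incr_diff_const fun_eq_iff algebra_simps)

text \<open>The diagonal part is multiplication by a bounded function. The off-diagonal part has
  absolutely summable values with total at most \<open>C * lp_norm p f\<close>, and this total
  dominates its norm in \<open>lp p\<close>.\<close>

lemma symbol_op_bounded:
  assumes p: "1 \<le> p" "p < \<infinity>" and a: "symbol p a"
  shows "lp_bounded_operator p (symbol_op a)"
proof -
  obtain M where M: "\<And>v. norm (a v) \<le> M" using a unfolding symbol_def by blast
  have M0: "0 \<le> M" using M norm_ge_zero order_trans by blast
  obtain C where C: "C \<ge> 0" and Cb: "\<And>f. f \<in> lp p \<Longrightarrow>
      (\<Sum>\<^sub>\<infinity>w. real (lev w + 1) * norm (incr a w * f w)) \<le> C * lp_norm p f"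
    using a unfolding symbol_def by blast
  have ls: "level_summable (\<lambda>w. incr a w * f w)" if "f \<in> lp p" for f
    using a that unfolding symbol_def by blast
  have diag: "(\<lambda>v. a v * f v) \<in> lp p" "lp_norm p (\<lambda>v. a v * f v) \<le> M * lp_norm p f"
    if "f \<in> lp p" for f
    using lp_dominated[OF p that _ M0, of "\<lambda>v. a v * f v"] M
    by (simp_all add: norm_mult mult_right_mono)
  have tail: "tail_sum (\<lambda>w. incr a w * f w) \<in> lp p"
    "lp_norm p (tail_sum (\<lambda>w. incr a w * f w)) \<le> C * lp_norm p f" if f: "f \<in> lp p" for f
  proof -
    note ts = tail_sum_summable[OF ls[OF f]]
    show "tail_sum (\<lambda>w. incr a w * f w) \<in> lp p"
      by (rule abs_summable_in_lp(1)[OF p ts(1)])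
    show "lp_norm p (tail_sum (\<lambda>w. incr a w * f w)) \<le> C * lp_norm p f"
      using abs_summable_in_lp(2)[OF p ts(1)] ts(2) Cb[OF f] by linarith
  qed
  have symbol_op_eq: "symbol_op a f = (\<lambda>v. a v * f v + tail_sum (\<lambda>w. incr a w * f w) v)" for f
    by (simp add: symbol_op_def fun_eq_iff)
  have bound: "lp_norm p (symbol_op a f) \<le> (2 * (M + C)) * lp_norm p f" if f: "f \<in> lp p" for f
    using lp_add(2)[OF p diag(1)[OF f] tail(1)[OF f]] diag(2)[OF f] tail(2)[OF f]
    by (simp add: symbol_op_eq algebra_simps)
  have mem: "symbol_op a f \<in> lp p" if "f \<in> lp p" for f
    unfolding symbol_op_eq by (rule lp_add(1)[OF p diag(1)[OF that] tail(1)[OF that]])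
  have add: "symbol_op a (\<lambda>v. f v + g v) = (\<lambda>v. symbol_op a f v + symbol_op a g v)"
    if "f \<in> lp p" "g \<in> lp p" for f g
    using tail_sum_add[OF ls[OF that(1)] ls[OF that(2)]]
    by (simp add: symbol_op_def fun_eq_iff algebra_simps)
  have scale: "symbol_op a (\<lambda>v. c * f v) = (\<lambda>v. c * symbol_op a f v)" for c f
    using tail_sum_scale[of c "\<lambda>w. incr a w * f w"]
    by (simp add: symbol_op_def fun_eq_iff algebra_simps)
  show ?thesis unfolding lp_bounded_operator_def
    using bound mem add scale by blast
qed

text \<open>Expanding the composition produces one double tail, which telescopes; the terms with
  \<open>a u\<close> then cancel, and the discrete product rule assembles the rest into the
  increment of the product.\<close>

lemma symbol_op_mult:
  assumes p: "1 \<le> p" "p < \<infinity>" and a: "symbol p a" and b: "symbol p b" and f: "f \<in> lp p"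
  shows "symbol_op a (symbol_op b f) = symbol_op (\<lambda>v. a v * b v) f"
proof
  fix u
  obtain M where M: "\<And>v. norm (a v) \<le> M" using a unfolding symbol_def by blast
  obtain N where N: "\<And>v. norm (b v) \<le> N" using b unfolding symbol_def by blast
  let ?h = "\<lambda>w. incr b w * f w"
  have h: "level_summable ?h" using b f unfolding symbol_def by blast
  have af: "level_summable (\<lambda>w. incr a w * g w)" if "g \<in> lp p" for g
    using a that unfolding symbol_def by blast
  have ab: "level_summable (\<lambda>w. incr a w * (b w * f w))"
    using level_summable_mult[OF af[OF f], of b N] N by (simp add: mult.left_commute)
  have "tail_sum ?h \<in> lp p"
    using abs_summable_in_lp(1)[OF p] tail_sum_summable(1)[OF h] .
  \<comment> \<open>The summability clause for \<open>a\<close> is applied to the tail itself as a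
    member of \<open>lp p\<close>.\<close>
  then have at: "level_summable (\<lambda>w. incr a w * tail_sum ?h w)" by (rule af)
  have ah: "level_summable (\<lambda>x. (a (par x) - a u) * ?h x)"
  proof (rule level_summable_mult[OF h])
    show "norm (a (par x) - a u) \<le> M + M" for x
      using norm_triangle_ineq4[of "a (par x)" "a u"] M[of "par x"] M[of u] by linarith
  qed
  have au: "level_summable (\<lambda>x. a u * ?h x)"
    by (rule level_summable_mult[OF h]) (rule M)
  have "symbol_op a (symbol_op b f) u = a u * (b u * f u + tail_sum ?h u)
      + tail_sum (\<lambda>w. incr a w * (b w * f w) + incr a w * tail_sum ?h w) u"
    by (simp add: symbol_op_def distrib_left)
  also have "\<dots> = a u * b u * f u + (tail_sum (\<lambda>w. a u * ?h w) u
      + (tail_sum (\<lambda>w. incr a w * (b w * f w)) u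
      + tail_sum (\<lambda>x. (a (par x) - a u) * ?h x) u))"
    unfolding tail_sum_add[OF ab at] tail_sum_incr_tail_sum[OF h M] tail_sum_scale
    by (simp add: algebra_simps)
  also have "tail_sum (\<lambda>w. a u * ?h w) u + (tail_sum (\<lambda>w. incr a w * (b w * f w)) u
      + tail_sum (\<lambda>x. (a (par x) - a u) * ?h x) u)
      = (\<Sum>\<^sub>\<infinity>x\<in>below u. a u * ?h x + (incr a x * (b x * f x) + (a (par x) - a u) * ?h x))"
    unfolding tail_sum_def
    by (simp only: infsum_add summable_on_add level_summable_imp_summable[OF ab]
        level_summable_imp_summable[OF ah] level_summable_imp_summable[OF au])
  \<comment> \<open>After \<open>a u\<close> cancels, this is
    \<open>incr (a b) x = incr a x * b x + a (par x) * incr b x\<close>, where \<open>x\<close> is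
    not the root.\<close>
  also have "\<dots> = tail_sum (\<lambda>x. incr (\<lambda>v. a v * b v) x * f x) u"
    unfolding tail_sum_def
    by (rule infsum_cong) (auto simp: incr_def below_iff algebra_simps)
  finally show "symbol_op a (symbol_op b f) u = symbol_op (\<lambda>v. a v * b v) f u"
    by (simp add: symbol_op_def)
qed

subsection \<open>Toeplitz operators and their spectrum\<close>

lemma tree_nabla_eq: "tree_nabla adj r f v = f v - (\<Sum>c\<in>children v. f c)"
  by (simp add: tree_nabla_def children_def)

lemma tail_sum_children:
  assumes "level_summable h"
  shows "tail_sum h v = (\<Sum>c\<in>children v. h c + tail_sum h c)"
proof -
  have "(\<Sum>c\<in>children v. infsum h (sector adj r c)) = tail_sum h v"
    unfolding tail_sum_def below_eq_Union
    by (rule sum_infsum[OF finite_children level_summable_imp_summable[OF assms]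
          disjoint_child_sectors])
  moreover have "infsum h (sector adj r c) = h c + tail_sum h c" for c
    unfolding tail_sum_def sector_insert
    by (rule infsum_insert[OF level_summable_imp_summable[OF assms] not_below_self])
  ultimately show ?thesis by simp
qed

text \<open>The tail at \<open>v\<close> exceeds the tails of the children by the sum of
  \<open>incr a c * f c\<close>; subtracting \<open>a c * f c\<close> over the children leaves
  \<open>- a v * f c\<close>.\<close>

lemma nabla_symbol_op:
  assumes "level_summable (\<lambda>w. incr a w * f w)"
  shows "tree_nabla adj r (symbol_op a f) v = a v * tree_nabla adj r f v"
proof -
  have "(\<Sum>c\<in>children v. incr a c * f c) = (\<Sum>c\<in>children v. a c * f c - a v * f c)"
    by (rule sum.cong) (auto simp: incr_def children_def algebra_simps)
  then show ?thesis
    unfolding tree_nabla_eq symbol_op_def tail_sum_children[OF assms, of v]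
    by (simp add: algebra_simps sum.distrib sum_subtractf sum_distrib_left)
qed

text \<open>An edge whose upper end lies in the sector of \<open>u\<close> is determined by its
  lower end, which is a strict descendant of \<open>u\<close>.\<close>

lemma bij_betw_children_below: "bij_betw snd (Sigma (sector adj r u) children) (below u)"
proof (rule bij_betwI')
  show "\<exists>x\<in>Sigma (sector adj r u) children. w = snd x" if "w \<in> below u" for w
    using that by (intro bexI[of _ "(par w, w)"]) (auto simp: below_iff children_def sector_eq)
qed (auto simp: below_iff children_def sector_eq)

text \<open>Summation by parts: the sum over vertices and their children is reindexed by the lower
  ends of the edges, where \<open>f w\<close> meets \<open>a (par w)\<close>, and combines with
  \<open>a w * f w\<close> to the increment.\<close>

lemma toeplitz_eq_symbol_op:
  assumes af: "(\<lambda>v. norm (a v * f v)) summable_on UNIV"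
    and inc: "level_summable (\<lambda>w. incr a w * f w)"
  shows "toeplitz adj r a f = symbol_op a f"
proof
  fix u
  let ?S = "sector adj r u"
  let ?shift = "\<lambda>w. a (par w) * f w"
  have af': "(\<lambda>v. a v * f v) summable_on A" for A
    using abs_summable_summable[OF af] by (rule summable_on_subset_banach) simp
  have inc_below: "incr a w * f w = a w * f w - ?shift w" if "w \<in> below u" for w
    using that by (simp add: incr_def below_iff algebra_simps)
  \<comment> \<open>Summability of the shifted product is obtained by writing it as
    \<open>a w * f w - incr a w * f w\<close>.\<close>
  have shift: "?shift summable_on below u"
  proof -
    have "(\<lambda>w. a w * f w - incr a w * f w) summable_on below u"
      by (intro summable_on_diff af' level_summable_imp_summable[OF inc])
    then show ?thesis
      by (rule summable_on_cong[THEN iffD1, rotated]) (simp add: inc_below)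
  qed
  have sigma: "(\<lambda>vw. ?shift (snd vw)) summable_on Sigma ?S children"
    using summable_on_reindex_bij_betw[OF bij_betw_children_below, of ?shift] shift by simp
  have inner: "(\<Sum>\<^sub>\<infinity>w\<in>children v. ?shift (snd (v, w))) = a v * (\<Sum>w\<in>children v. f w)" for v
  proof -
    have "(\<Sum>w\<in>children v. ?shift w) = (\<Sum>w\<in>children v. a v * f w)"
      by (rule sum.cong) (auto simp: children_def)
    then show ?thesis by (simp add: finite_children sum_distrib_left)
  qed
  have "(\<Sum>\<^sub>\<infinity>v\<in>?S. a v * (\<Sum>w\<in>children v. f w)) = infsum ?shift (below u)"
    using infsum_Sigma_banach[OF sigma]
      infsum_reindex_bij_betw[OF bij_betw_children_below, of ?shift] unfolding inner by simp
  moreover have "(\<lambda>v. a v * (\<Sum>w\<in>children v. f w)) summable_on ?S"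
    using summable_on_Sigma_banach[of "\<lambda>v w. ?shift w" ?S children] sigma inner
    by (simp add: case_prod_unfold)
  ultimately have "toeplitz adj r a f u = infsum (\<lambda>v. a v * f v) ?S - infsum ?shift (below u)"
    by (simp add: toeplitz_def tree_Delta_def tree_nabla_eq right_diff_distrib infsum_diff af')
  also have "infsum (\<lambda>v. a v * f v) ?S = a u * f u + infsum (\<lambda>v. a v * f v) (below u)"
    unfolding sector_insert by (rule infsum_insert[OF af' not_below_self])
  also have "\<dots> - infsum ?shift (below u) = a u * f u + infsum (\<lambda>w. a w * f w - ?shift w) (below u)"
    by (simp add: infsum_diff af' shift)
  also have "infsum (\<lambda>w. a w * f w - ?shift w) (below u) = tail_sum (\<lambda>w. incr a w * f w) u"
    unfolding tail_sum_def by (rule infsum_cong) (simp add: inc_below)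
  finally show "toeplitz adj r a f u = symbol_op a f u" by (simp add: symbol_op_def)
qed

section \<open>Admissible symbols and their reciprocals\<close>

text \<open>The factor \<open>|v| + 1\<close> in \<open>weighted_deriv\<close> is the weight of
  \<open>level_summable\<close>, so Hoelder's inequality against
  \<open>weighted_deriv adj r \<phi>\<close> gives the last two clauses.\<close>

lemma symbolI:
  assumes p: "1 \<le> p" "p < \<infinity>" and pq: "1 / p + 1 / q = 1"
    and \<phi>: "\<phi> \<in> lp q" and w\<phi>: "weighted_deriv adj r \<phi> \<in> lp q"
  shows "symbol p \<phi>"
proof -
  consider (one) "q = \<infinity>" | (real) "q \<noteq> \<infinity>" "1 < enn2real q"
    using conjugate_exponent_cases[OF p pq] by metis
  then have bdd: "\<exists>M. \<forall>v. norm (\<phi> v) \<le> M"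
  proof cases
    case one
    then show ?thesis using \<phi> by (auto simp: lp_def bounded_iff)
  next
    case real
    then have "q = ennreal (enn2real q)" by (simp add: top.not_eq_extremum)
    then have "1 \<le> q" using real(2) by (metis ennreal_1 ennreal_leI less_imp_le)
    moreover have "q < \<infinity>" using real(1) by (simp add: top.not_eq_extremum)
    \<comment> \<open>The pointwise bound is used here with \<open>q\<close> in the role of
      \<open>p\<close>.\<close>
    ultimately show ?thesis using norm_le_lp_norm[OF _ _ \<phi>] by blast
  qed
  let ?g = "weighted_deriv adj r \<phi>"
  obtain C where C: "0 \<le> C"
    and Cs: "\<And>f. f \<in> lp p \<Longrightarrow> (\<lambda>v. norm (?g v * f v)) summable_on UNIV"
    and Cb: "\<And>f. f \<in> lp p \<Longrightarrow> (\<Sum>\<^sub>\<infinity>v. norm (?g v * f v)) \<le> C * lp_norm p f"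
    using holder_bound[OF p pq w\<phi>] by metis
  have pw: "real (lev w + 1) * norm (incr \<phi> w * f w) \<le> norm (?g w * f w)" for f w
  proof -
    have "norm (?g w) = real (lev w + 1) * norm (tree_deriv adj r \<phi> w)"
      by (simp only: weighted_deriv_def norm_mult norm_of_nat)
    \<comment> \<open>Away from the root both sides agree; at the root \<open>incr\<close> is 0
      while \<open>tree_deriv\<close> is \<open>\<phi> r\<close>.\<close>
    moreover have "norm (incr \<phi> w) \<le> norm (tree_deriv adj r \<phi> w)"
      by (simp add: incr_def tree_deriv_def shift_fun_def)
    ultimately have "real (lev w + 1) * norm (incr \<phi> w) \<le> norm (?g w)"
      by (simp add: mult_left_mono)
    then have "real (lev w + 1) * norm (incr \<phi> w) * norm (f w) \<le> norm (?g w) * norm (f w)"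
      by (rule mult_right_mono) simp
    then show ?thesis by (simp only: norm_mult mult.assoc)
  qed
  have ls: "level_summable (\<lambda>w. incr \<phi> w * f w)" if "f \<in> lp p" for f
    unfolding level_summable_def using Cs[OF that]
    by (rule summable_on_comparison_test) (rule pw, simp)
  have "(\<Sum>\<^sub>\<infinity>w. real (lev w + 1) * norm (incr \<phi> w * f w)) \<le> C * lp_norm p f"
    if f: "f \<in> lp p" for f
  proof -
    have "(\<Sum>\<^sub>\<infinity>w. real (lev w + 1) * norm (incr \<phi> w * f w)) \<le> (\<Sum>\<^sub>\<infinity>v. norm (?g v * f v))"
      using ls[OF f, unfolded level_summable_def] Cs[OF f] by (rule infsum_mono) (rule pw)
    then show ?thesis using Cb[OF f] by linarith
  qed
  then show ?thesis unfolding symbol_def using bdd ls C by blast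
qed

lemma symbol_diff_const: "symbol p a \<Longrightarrow> symbol p (\<lambda>v. a v - z)"
proof -
  assume a: "symbol p a"
  then obtain M where M: "\<And>v. norm (a v) \<le> M" unfolding symbol_def by blast
  show ?thesis
  proof (rule symbol_dominated[OF a, where M = "M + norm z" and K = 1])
    show "norm (a v - z) \<le> M + norm z" for v
      using norm_triangle_ineq4[of "a v" z] M[of v] by linarith
  qed (simp_all add: incr_diff_const)
qed

text \<open>A difference of reciprocals is minus the difference divided by the product of the two
  values, whence \<open>K\<close> is the square of \<open>1 / d\<close>.\<close>

lemma symbol_inverse:
  assumes a: "symbol p a" and d: "0 < d" and le: "\<And>v. d \<le> norm (a v)"
  shows "symbol p (\<lambda>v. 1 / a v)"
proof (rule symbol_dominated[OF a, where M = "1 / d" and K = "1 / d * (1 / d)"])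
  show inv_le: "norm (1 / a v) \<le> 1 / d" for v
    using d le[of v] by (simp add: norm_divide frac_le)
  have nz: "a v \<noteq> 0" for v using d le[of v] by auto
  show "norm (incr (\<lambda>v. 1 / a v) w) \<le> 1 / d * (1 / d) * norm (incr a w)" for w
  proof -
    have "incr (\<lambda>v. 1 / a v) w = - ((1 / a w) * (1 / a (par w)) * incr a w)"
      using nz by (simp add: incr_def field_simps)
    then have "norm (incr (\<lambda>v. 1 / a v) w)
        = norm (1 / a w) * norm (1 / a (par w)) * norm (incr a w)"
      by (simp only: norm_minus_cancel norm_mult)
    also have "\<dots> \<le> 1 / d * (1 / d) * norm (incr a w)"
      using inv_le d by (intro mult_right_mono mult_mono) auto
    finally show ?thesis .
  qed
qed (use d in auto)

section \<open>The two inclusions for the spectrum\<close>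

text \<open>This makes the functional \<open>g \<mapsto> tree_nabla adj r g v\<close> bounded, so
  that the supremum over the unit ball taken below is finite.\<close>

lemma norm_nabla_le:
  assumes p: "1 \<le> p" "p < \<infinity>" and g: "g \<in> lp p"
  shows "norm (tree_nabla adj r g v) \<le> (1 + real (card (children v))) * lp_norm p g"
proof -
  note le = norm_le_lp_norm[OF p g]
  have "norm (tree_nabla adj r g v) \<le> norm (g v) + norm (\<Sum>c\<in>children v. g c)"
    unfolding tree_nabla_eq by (rule norm_triangle_ineq4)
  also have "norm (\<Sum>c\<in>children v. g c) \<le> real (card (children v)) * lp_norm p g"
    using le by (intro sum_norm_bound)
  finally show ?thesis using le[of v] by (simp add: algebra_simps)
qed

text \<open>The functional \<open>L g = (\<nabla> g) v\<close> is an eigenvector of the adjoint for the eigenvalue \<open>a v\<close>.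
  Testing it on near-maximisers instead of on a point mass makes the estimate independent of the
  number of children of \<open>v\<close>, hence usable for limits of values of \<open>a\<close>.\<close>

lemma inverse_bound_lower:
  assumes p: "1 \<le> p" "p < \<infinity>" and a: "symbol p a"
    and B: "\<And>f. f \<in> lp p \<Longrightarrow> B f \<in> lp p" "\<And>f. f \<in> lp p \<Longrightarrow> lp_norm p (B f) \<le> C * lp_norm p f"
    and inv: "\<And>f. f \<in> lp p \<Longrightarrow> symbol_op a (B f) = f" and C: "0 < C"
  shows "1 \<le> 2 * C * norm (a v)"
proof -
  let ?L = "\<lambda>g. norm (tree_nabla adj r g v)"
  let ?U = "{g \<in> lp p. lp_norm p g \<le> 1}"
  define N where "N = Sup (?L ` ?U)"
  have bdd: "bdd_above (?L ` ?U)"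
  proof (rule bdd_aboveI2)
    fix g :: "'a \<Rightarrow> complex" assume g: "g \<in> ?U"
    then have "?L g \<le> (1 + real (card (children v))) * lp_norm p g"
      using norm_nabla_le[OF p] by blast
    also have "\<dots> \<le> 1 + real (card (children v))"
      using g mult_left_mono[of "lp_norm p g" 1 "1 + real (card (children v))"] by simp
    finally show "?L g \<le> 1 + real (card (children v))" .
  qed
  \<comment> \<open>The point mass at \<open>v\<close> has \<open>?L \<delta> = 1\<close>, since
    \<open>v\<close> is not its own child. Hence \<open>N\<close> is positive and can be cancelled
    at the end.\<close>
  define \<delta> where "\<delta> = (\<lambda>w. if w = v then 1 else 0 :: complex)"
  have \<delta>_sum: "((\<lambda>w. norm (\<delta> w)) has_sum 1) UNIV"
    by (rule has_sum_finite_neutralI[where B = "{v}"]) (auto simp: \<delta>_def)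
  have "\<delta> \<in> lp p" "lp_norm p \<delta> \<le> 1"
    using abs_summable_in_lp[OF p, of \<delta>] \<delta>_sum infsumI[OF \<delta>_sum]
    by (auto simp: summable_on_def)
  moreover have "v \<notin> children v" using not_anc_parent[of v] by (auto simp: children_def)
  then have "(\<Sum>c\<in>children v. \<delta> c) = 0" unfolding \<delta>_def by (intro sum.neutral) auto
  then have "?L \<delta> = 1" by (simp add: tree_nabla_eq \<delta>_def)
  ultimately have N: "1 \<le> N"
    unfolding N_def using cSUP_upper[OF _ bdd, of \<delta>] by auto
  have L_le: "?L g \<le> N * K" if g: "g \<in> lp p" "lp_norm p g \<le> K" and K: "0 < K" for g K
  proof -
    define g1 where "g1 = (\<lambda>w. complex_of_real (1 / K) * g w)"
    have "g1 \<in> lp p"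
      using lp_dominated(1)[OF p g(1), of g1 "1 / K"] K by (simp add: g1_def norm_mult norm_divide)
    moreover have "lp_norm p g1 \<le> 1"
      using lp_norm_scale[OF p g(1), of "complex_of_real (1 / K)"] K g(2)
      by (simp add: g1_def norm_divide)
    ultimately have "?L g1 \<le> N" unfolding N_def using bdd by (intro cSUP_upper) auto
    moreover have "tree_nabla adj r g1 v = complex_of_real (1 / K) * tree_nabla adj r g v"
      by (simp add: tree_nabla_eq g1_def sum_distrib_left right_diff_distrib)
    then have "?L g1 = ?L g / K" using K by (simp add: norm_mult norm_divide)
    ultimately show ?thesis using K by (simp add: field_simps)
  qed
  \<comment> \<open>As \<open>N / 2 < N\<close>, some member of the unit ball exceeds it; the factor
    2 in the conclusion comes from here.\<close>
  have "\<exists>g\<in>?U. N / 2 < ?L g"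
    unfolding N_def using bdd N \<open>\<delta> \<in> lp p\<close> \<open>lp_norm p \<delta> \<le> 1\<close>
    by (intro less_cSUP_iff[THEN iffD1]) (auto simp: N_def)
  then obtain f where f: "f \<in> lp p" "lp_norm p f \<le> 1" "N / 2 < ?L f" by blast
  have "lp_norm p (B f) \<le> C"
    using B(2)[OF f(1)] f(2) C mult_left_mono[of "lp_norm p f" 1 C] by linarith
  then have LB: "?L (B f) \<le> N * C" using B(1)[OF f(1)] C by (intro L_le)
  have "level_summable (\<lambda>w. incr a w * B f w)" using a B(1)[OF f(1)] unfolding symbol_def by blast
  \<comment> \<open>Since \<open>f\<close> is the image of \<open>B f\<close>, the eigenvector
    relation gives \<open>N / 2 < norm (a v) * N * C\<close>.\<close>
  from nabla_symbol_op[OF this, of v] have "?L f = norm (a v) * ?L (B f)"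
    by (simp add: inv[OF f(1)] norm_mult)
  also have "\<dots> \<le> norm (a v) * (N * C)" using LB by (rule mult_left_mono) simp
  finally have "N * 1 \<le> N * (2 * C * norm (a v))" using f(3) by (simp add: algebra_simps)
  then show ?thesis using N by (simp add: mult_le_cancel_left)
qed

text \<open>A bounded inverse of \<open>T - z\<close> keeps every value of \<open>a\<close> at
  distance at least \<open>1 / (2 * C)\<close> from \<open>z\<close>; conversely, positive distance
  from the range makes \<open>1 / (a - z)\<close> a symbol, and its operator is the inverse by
  multiplicativity.\<close>

lemma spectrum_symbol_op:
  assumes p: "1 \<le> p" "p < \<infinity>" and a: "symbol p a"
    and T: "\<And>f. f \<in> lp p \<Longrightarrow> T f = symbol_op a f"
  shows "lp_spectrum p T = closure (range a)"
proof (intro equalityI subsetI)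
  fix z assume z: "z \<in> closure (range a)"
  show "z \<in> lp_spectrum p T"
  proof (rule ccontr)
    assume "z \<notin> lp_spectrum p T"
    then obtain B where B: "lp_bounded_operator p B"
      and inv: "\<And>f. f \<in> lp p \<Longrightarrow> (\<lambda>v. T (B f) v - z * B f v) = f"
      by (auto simp: lp_spectrum_def)
    have mem: "B f \<in> lp p" if "f \<in> lp p" for f
      using B that by (auto simp: lp_bounded_operator_def)
    obtain C0 where C0: "\<And>f. f \<in> lp p \<Longrightarrow> lp_norm p (B f) \<le> C0 * lp_norm p f"
      using B unfolding lp_bounded_operator_def by blast
    \<comment> \<open>The bound of an operator may come with a nonpositive constant, so it is raised
      to at least 1.\<close>
    define C where "C = max C0 1"
    have C: "lp_norm p (B f) \<le> C * lp_norm p f" if "f \<in> lp p" for f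
      using C0[OF that] mult_right_mono[of C0 C "lp_norm p f"] lp_norm_nonneg[OF p, of f]
      by (simp add: C_def)
    have inv': "symbol_op (\<lambda>v. a v - z) (B f) = f" if "f \<in> lp p" for f
      using inv[OF that] T[OF mem[OF that]] by (simp add: symbol_op_diff_const)
    have C_pos: "0 < C" by (simp add: C_def)
    then obtain v where "dist (a v) z < 1 / (2 * C)"
      using z unfolding closure_approachable
      by (metis divide_pos_pos mult_pos_pos rangeE zero_less_numeral zero_less_one)
    moreover have "1 \<le> 2 * C * norm (a v - z)"
      using inverse_bound_lower[OF p symbol_diff_const[OF a] mem C inv' C_pos] .
    ultimately show False using C_pos by (simp add: dist_norm field_simps)
  qed
next
  fix z assume "z \<in> lp_spectrum p T"
  show "z \<in> closure (range a)"
  proof (rule ccontr)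
    assume "z \<notin> closure (range a)"
    then obtain d where d: "0 < d" and dist: "\<And>v. d \<le> norm (a v - z)"
      unfolding closure_approachable by (auto simp: dist_norm not_less)
    let ?b = "\<lambda>v. a v - z" and ?B = "symbol_op (\<lambda>v. 1 / (a v - z))"
    have b: "symbol p ?b" by (rule symbol_diff_const[OF a])
    have ib: "symbol p (\<lambda>v. 1 / (a v - z))" by (rule symbol_inverse[OF b d dist])
    have B: "lp_bounded_operator p ?B" by (rule symbol_op_bounded[OF p ib])
    have nz: "a v - z \<noteq> 0" for v using d dist[of v] by auto
    have "?B (\<lambda>v. T f v - z * f v) = f \<and> (\<lambda>v. T (?B f) v - z * ?B f v) = f"
      if f: "f \<in> lp p" for f
    proof
      have "?B (\<lambda>v. T f v - z * f v) = ?B (symbol_op ?b f)"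
        by (simp only: T[OF f] symbol_op_diff_const)
      also have "\<dots> = symbol_op (\<lambda>v. 1) f" using nz by (simp add: symbol_op_mult[OF p ib b f])
      finally show "?B (\<lambda>v. T f v - z * f v) = f" by (simp add: symbol_op_const)
      have Bf: "?B f \<in> lp p" using B f unfolding lp_bounded_operator_def by blast
      have "(\<lambda>v. T (?B f) v - z * ?B f v) = symbol_op ?b (?B f)"
        by (simp only: T[OF Bf] symbol_op_diff_const)
      also have "\<dots> = symbol_op (\<lambda>v. 1) f" using nz by (simp add: symbol_op_mult[OF p b ib f])
      finally show "(\<lambda>v. T (?B f) v - z * ?B f v) = f" by (simp add: symbol_op_const)
    qed
    then show False using \<open>z \<in> lp_spectrum p T\<close> B unfolding lp_spectrum_def by blast
  qed
qed

end

text \<open>The linearity clauses evaluate \<open>T\<close> at sums and multiples, so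
  \<open>lp p\<close> must be closed under these before \<open>T\<close> can be replaced by
  \<open>A\<close>.\<close>

lemma lp_bounded_operator_cong:
  assumes p: "1 \<le> p" "p < \<infinity>" and A: "lp_bounded_operator p A"
    and eq: "\<And>f. f \<in> lp p \<Longrightarrow> T f = A f"
  shows "lp_bounded_operator p T"
proof -
  have "(\<lambda>v. c * f v) \<in> lp p" if "f \<in> lp p" for c and f :: "'a \<Rightarrow> complex"
    using lp_dominated(1)[OF p that, of "\<lambda>v. c * f v" "norm c"] by (simp add: norm_mult)
  moreover have "(\<lambda>v. f v + g v) \<in> lp p" if "f \<in> lp p" "g \<in> lp p"
    for f g :: "'a \<Rightarrow> complex"
    by (rule lp_add(1)[OF p that])
  ultimately show ?thesis
    using A unfolding lp_bounded_operator_def by (simp add: eq)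
qed

theorem theorem3p1:
  fixes adj :: "'a \<Rightarrow> 'a \<Rightarrow> bool" and r :: 'a
    and p q :: ennreal and \<phi> :: "'a \<Rightarrow> complex"
  assumes "tree adj"
    and "countable (UNIV :: 'a set)" and "infinite (UNIV :: 'a set)"
    and "\<And>v. \<not> terminal_vertex adj v"
    and "1 \<le> p" and "p < \<infinity>" and "1 / p + 1 / q = 1"
    and "\<phi> \<in> lp q" and "weighted_deriv adj r \<phi> \<in> lp q"
  shows "lp_bounded_operator p (toeplitz adj r \<phi>) \<and>
         lp_spectrum p (toeplitz adj r \<phi>) = closure (range \<phi>)"
proof -
  interpret rooted_tree adj r using assms(1) by (simp add: rooted_tree_def)
  note p = assms(5,6)
  have \<phi>: "symbol p \<phi>" by (rule symbolI[OF p assms(7-9)])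
  have eq: "toeplitz adj r \<phi> f = symbol_op \<phi> f" if f: "f \<in> lp p" for f
  proof (rule toeplitz_eq_symbol_op)
    show "(\<lambda>v. norm (\<phi> v * f v)) summable_on UNIV"
      using holder_bound[OF p assms(7,8)] f by metis
    show "level_summable (\<lambda>w. incr \<phi> w * f w)" using \<phi> f unfolding symbol_def by blast
  qed
  show ?thesis
    using lp_bounded_operator_cong[OF p symbol_op_bounded[OF p \<phi>] eq]
      spectrum_symbol_op[OF p \<phi> eq]
    by blast
qed

end
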